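(* Let $\mathbf{A}$ be a complete BL-algebra and $\mathcal{P}=\langle W,\pi\rangle$ a possibilistic $\mathbf{A}$-frame. Then the complex $\mathbf{A}$-algebra $\langle\mathbf{A}^W,\forall^{\mathcal{P}},\exists^{\mathcal{P}}\rangle$ is an Epistemic BL-algebra, and $\pi$ is its focal element, i.e. $\pi=\min\{f\in A^W:\forall^{\mathcal{P}}f=1\}$; thus it is a c-EBL-algebra with $c=\pi$.
   Context: A BL-algebra is an algebra $\langle A,\wedge,\vee,\ast,\to,0,1\rangle$ such that $\langle A,\wedge,\vee,0,1\rangle$ is a bounded lattice (order $\le$), $\langle A,\ast,1\rangle$ is a commutative monoid, $a\ast b\le c$ iff $a\le b\to c$, and $a\wedge b=a\ast(a\to b)$ and $(a\to b)\vee(b\to a)=1$ hold; it is complete if every subset has a supremum and an infimum. An Epistemic BL-algebra is a BL-algebra with unary operations $\forall,\exists$ satisfying, for all $a,b$: $\forall 1=1$; $\exists 0=0$; $\forall a\to\exists a=1$; $\forall(a\to\forall b)=\exists a\to\forall b$; $\forall(\forall a\to b)=\forall a\to\forall b$; $\exists a\to\forall\exists a=1$; $\forall(a\wedge b)=\forall a\wedge\forall b$; $\exists(a\vee b)=\exists a\vee\exists b$; $\exists(a\ast\exists b)=\exists a\ast\exists b$. The focal element of an EBL-algebra is the least element of $\{a:\forall a=1\}$ when it exists; a c-EBL-algebra is one where it exists. A possibilistic $\mathbf{A}$-frame is a pair $\langle W,\pi\rangle$ with $W$ a non-empty set and $\pi:W\to A$ satisfying $\sup_{w\in W}\pi(w)=1$.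 $\mathbf{A}^W$ is the BL-algebra of all functions $W\to A$ with pointwise operations. For $f\in A^W$, $\forall^{\mathcal{P}}f$ is the constant function with value $\inf_{w\in W}\{\pi(w)\to f(w)\}$ and $\exists^{\mathcal{P}}f$ is the constant function with value $\sup_{w\in W}\{\pi(w)\ast f(w)\}$. *)

theory Defs
  imports "HOL-Algebra.Group"
begin

section \<open>BL-algebras\<close>

record 'a bl = "'a monoid" +
  bl_meet :: "['a, 'a] \<Rightarrow> 'a" (infixl \<open>\<curlywedge>\<index>\<close> 70)
  bl_join :: "['a, 'a] \<Rightarrow> 'a" (infixl \<open>\<curlyvee>\<index>\<close> 65)
  bl_imp :: "['a, 'a] \<Rightarrow> 'a" (infixr \<open>\<rightharpoonup>\<index>\<close> 60)
  bl_zero :: 'a (\<open>\<zero>\<index>\<close>)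

definition bl_le :: "('a, 'm) bl_scheme \<Rightarrow> 'a \<Rightarrow> 'a \<Rightarrow> bool" (infix \<open>\<preceq>\<index>\<close> 50)
  where "a \<preceq>\<^bsub>A\<^esub> b \<longleftrightarrow> a \<curlywedge>\<^bsub>A\<^esub> b = a"

definition bl_order :: "('a, 'm) bl_scheme \<Rightarrow> 'a gorder"
  where "bl_order A = \<lparr>carrier = carrier A, eq = (=), le = bl_le A\<rparr>"

locale bl_algebra = comm_monoid A for A :: "('a, 'm) bl_scheme" (structure) +
  assumes meet_closed: "\<lbrakk>a \<in> carrier A; b \<in> carrier A\<rbrakk> \<Longrightarrow> a \<curlywedge> b \<in> carrier A"
    and join_closed: "\<lbrakk>a \<in> carrier A; b \<in> carrier A\<rbrakk> \<Longrightarrow> a \<curlyvee> b \<in> carrier A"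
    and imp_closed: "\<lbrakk>a \<in> carrier A; b \<in> carrier A\<rbrakk> \<Longrightarrow> a \<rightharpoonup> b \<in> carrier A"
    and zero_closed: "\<zero> \<in> carrier A"
    and meet_assoc: "\<lbrakk>a \<in> carrier A; b \<in> carrier A; c \<in> carrier A\<rbrakk> \<Longrightarrow> (a \<curlywedge> b) \<curlywedge> c = a \<curlywedge> (b \<curlywedge> c)"
    and meet_comm: "\<lbrakk>a \<in> carrier A; b \<in> carrier A\<rbrakk> \<Longrightarrow> a \<curlywedge> b = b \<curlywedge> a"
    and join_assoc: "\<lbrakk>a \<in> carrier A; b \<in> carrier A; c \<in> carrier A\<rbrakk> \<Longrightarrow> (a \<curlyvee> b) \<curlyvee> c = a \<curlyvee> (b \<curlyvee> c)"
    and join_comm: "\<lbrakk>a \<in> carrier A; b \<in> carrier A\<rbrakk> \<Longrightarrow> a \<curlyvee> b = b \<curlyvee> a"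
    and meet_join_absorb: "\<lbrakk>a \<in> carrier A; b \<in> carrier A\<rbrakk> \<Longrightarrow> a \<curlywedge> (a \<curlyvee> b) = a"
    and join_meet_absorb: "\<lbrakk>a \<in> carrier A; b \<in> carrier A\<rbrakk> \<Longrightarrow> a \<curlyvee> (a \<curlywedge> b) = a"
    and zero_le: "a \<in> carrier A \<Longrightarrow> \<zero> \<preceq> a"
    and le_one: "a \<in> carrier A \<Longrightarrow> a \<preceq> \<one>"
    and residuation: "\<lbrakk>a \<in> carrier A; b \<in> carrier A; c \<in> carrier A\<rbrakk> \<Longrightarrow> a \<otimes> b \<preceq> c \<longleftrightarrow> a \<preceq> b \<rightharpoonup> c"
    and divisibility: "\<lbrakk>a \<in> carrier A; b \<in> carrier A\<rbrakk> \<Longrightarrow> a \<curlywedge> b = a \<otimes> (a \<rightharpoonup> b)"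
    and prelinearity: "\<lbrakk>a \<in> carrier A; b \<in> carrier A\<rbrakk> \<Longrightarrow> (a \<rightharpoonup> b) \<curlyvee> (b \<rightharpoonup> a) = \<one>"

locale complete_bl_algebra = bl_algebra +
  assumes complete: "complete_lattice (bl_order A)"


section \<open>Epistemic BL-algebras\<close>

record 'a ebl = "'a bl" +
  ebl_all :: "'a \<Rightarrow> 'a" (\<open>\<^bold>\<forall>\<index> _\<close> [81] 80)
  ebl_ex :: "'a \<Rightarrow> 'a" (\<open>\<^bold>\<exists>\<index> _\<close> [81] 80)

locale epistemic_bl_algebra = bl_algebra E for E :: "('a, 'm) ebl_scheme" (structure) +
  assumes all_closed: "a \<in> carrier E \<Longrightarrow> \<^bold>\<forall> a \<in> carrier E"
    and ex_closed: "a \<in> carrier E \<Longrightarrow> \<^bold>\<exists> a \<in> carrier E"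
    and all_one: "\<^bold>\<forall> \<one> = \<one>"
    and ex_zero: "\<^bold>\<exists> \<zero> = \<zero>"
    and all_imp_ex: "a \<in> carrier E \<Longrightarrow> (\<^bold>\<forall> a) \<rightharpoonup> (\<^bold>\<exists> a) = \<one>"
    and all_imp_all: "\<lbrakk>a \<in> carrier E; b \<in> carrier E\<rbrakk> \<Longrightarrow> \<^bold>\<forall> (a \<rightharpoonup> (\<^bold>\<forall> b)) = (\<^bold>\<exists> a) \<rightharpoonup> (\<^bold>\<forall> b)"
    and all_all_imp: "\<lbrakk>a \<in> carrier E; b \<in> carrier E\<rbrakk> \<Longrightarrow> \<^bold>\<forall> ((\<^bold>\<forall> a) \<rightharpoonup> b) = (\<^bold>\<forall> a) \<rightharpoonup> (\<^bold>\<forall> b)"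
    and ex_imp_all_ex: "a \<in> carrier E \<Longrightarrow> (\<^bold>\<exists> a) \<rightharpoonup> (\<^bold>\<forall> (\<^bold>\<exists> a)) = \<one>"
    and all_meet: "\<lbrakk>a \<in> carrier E; b \<in> carrier E\<rbrakk> \<Longrightarrow> \<^bold>\<forall> (a \<curlywedge> b) = (\<^bold>\<forall> a) \<curlywedge> (\<^bold>\<forall> b)"
    and ex_join: "\<lbrakk>a \<in> carrier E; b \<in> carrier E\<rbrakk> \<Longrightarrow> \<^bold>\<exists> (a \<curlyvee> b) = (\<^bold>\<exists> a) \<curlyvee> (\<^bold>\<exists> b)"
    and ex_mult_ex: "\<lbrakk>a \<in> carrier E; b \<in> carrier E\<rbrakk> \<Longrightarrow> \<^bold>\<exists> (a \<otimes> (\<^bold>\<exists> b)) = (\<^bold>\<exists> a) \<otimes> (\<^bold>\<exists> b)"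

definition focal_element :: "('a, 'm) ebl_scheme \<Rightarrow> 'a \<Rightarrow> bool"
  where "focal_element E c \<longleftrightarrow> least (bl_order E) c {a \<in> carrier E. \<^bold>\<forall>\<^bsub>E\<^esub> a = \<one>\<^bsub>E\<^esub>}"

locale c_ebl_algebra = epistemic_bl_algebra +
  assumes focal_exists: "\<exists>c. focal_element E c"


section \<open>Possibilistic frames and their complex algebras\<close>

text \<open>Maps from \<open>W\<close> to \<open>A\<close> are represented by the extensional functions
  \<open>W \<rightarrow>\<^sub>E carrier A\<close>, so that equality in \<open>A\<^sup>W\<close> is HOL equality.\<close>

definition possibilistic_frame :: "('a, 'm) bl_scheme \<Rightarrow> 'w set \<Rightarrow> ('w \<Rightarrow> 'a) \<Rightarrow> bool"
  where "possibilistic_frame A W \<pi> \<longleftrightarrow>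
    W \<noteq> {} \<and> \<pi> \<in> W \<rightarrow>\<^sub>E carrier A \<and> \<Squnion>\<^bsub>bl_order A\<^esub> {\<pi> w | w. w \<in> W} = \<one>\<^bsub>A\<^esub>"

definition complex_algebra ::
    "('a, 'm) bl_scheme \<Rightarrow> 'w set \<Rightarrow> ('w \<Rightarrow> 'a) \<Rightarrow> ('w \<Rightarrow> 'a) ebl"
  where "complex_algebra A W \<pi> =
    \<lparr>carrier = W \<rightarrow>\<^sub>E carrier A,
     mult = (\<lambda>f g. \<lambda>w\<in>W. f w \<otimes>\<^bsub>A\<^esub> g w),
     one = (\<lambda>w\<in>W. \<one>\<^bsub>A\<^esub>),
     bl_meet = (\<lambda>f g. \<lambda>w\<in>W. f w \<curlywedge>\<^bsub>A\<^esub> g w),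
     bl_join = (\<lambda>f g. \<lambda>w\<in>W. f w \<curlyvee>\<^bsub>A\<^esub> g w),
     bl_imp = (\<lambda>f g. \<lambda>w\<in>W. f w \<rightharpoonup>\<^bsub>A\<^esub> g w),
     bl_zero = (\<lambda>w\<in>W. \<zero>\<^bsub>A\<^esub>),
     ebl_all = (\<lambda>f. \<lambda>v\<in>W. \<Sqinter>\<^bsub>bl_order A\<^esub> {\<pi> w \<rightharpoonup>\<^bsub>A\<^esub> f w | w. w \<in> W}),
     ebl_ex = (\<lambda>f. \<lambda>v\<in>W. \<Squnion>\<^bsub>bl_order A\<^esub> {\<pi> w \<otimes>\<^bsub>A\<^esub> f w | w. w \<in> W})\<rparr>"

end

theory Submission
  imports Defs
begin

text \<open>By residuation, \<open>c \<le> \<forall>f\<close> iff \<open>c * \<pi> w \<le> f w\<close> for all \<open>w\<close>, and \<open>\<exists>f \<le> c\<close> iff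
  \<open>\<pi> w * f w \<le> c\<close> for all \<open>w\<close>. As multiplication preserves suprema, \<open>sup \<pi> = 1\<close> says that
  \<open>k \<le> c\<close> iff \<open>\<pi> w * k \<le> c\<close> for all \<open>w\<close>. With these three equivalences each equational axiom is
  checked by comparing the lower (or upper) bounds of both sides. Only \<open>\<forall>f \<le> \<exists>f\<close> needs prelinearity:
  it gives \<open>x * y \<le> x\<^sup>2 \<or> y\<^sup>2\<close>, hence \<open>sup \<pi>\<^sup>2 = 1\<close>, while \<open>\<forall>f * \<pi>\<^sup>2 \<le> \<pi> * f \<le> \<exists>f\<close> pointwise.\<close>

section \<open>Order, residuation and prelinearity in a BL-algebra\<close>

context bl_algebra
begin

lemmas bl_closed = meet_closed join_closed imp_closed zero_closed m_closed one_closed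

lemma bl_le_refl: "a \<in> carrier A \<Longrightarrow> a \<preceq> a"
  unfolding bl_le_def by (metis join_closed join_meet_absorb meet_closed meet_join_absorb)

lemma bl_le_antisym: "\<lbrakk>a \<preceq> b; b \<preceq> a; a \<in> carrier A; b \<in> carrier A\<rbrakk> \<Longrightarrow> a = b"
  unfolding bl_le_def by (metis meet_comm)

lemma bl_le_trans:
  "\<lbrakk>a \<preceq> b; b \<preceq> c; a \<in> carrier A; b \<in> carrier A; c \<in> carrier A\<rbrakk> \<Longrightarrow> a \<preceq> c"
  unfolding bl_le_def by (metis meet_assoc)

lemma le_meet_iff:
  assumes "a \<in> carrier A" "b \<in> carrier A" "c \<in> carrier A"
  shows "c \<preceq> a \<curlywedge> b \<longleftrightarrow> c \<preceq> a \<and> c \<preceq> b"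
proof
  have "a \<curlywedge> b \<preceq> a" "a \<curlywedge> b \<preceq> b"
    using assms bl_le_refl unfolding bl_le_def by (metis meet_assoc meet_comm)+
  then show "c \<preceq> a \<and> c \<preceq> b" if "c \<preceq> a \<curlywedge> b"
    using that assms bl_le_trans meet_closed by blast
  show "c \<preceq> a \<curlywedge> b" if "c \<preceq> a \<and> c \<preceq> b"
    using that assms unfolding bl_le_def by (metis meet_assoc)
qed

lemma bl_le_iff_join: "\<lbrakk>a \<in> carrier A; b \<in> carrier A\<rbrakk> \<Longrightarrow> a \<preceq> b \<longleftrightarrow> a \<curlyvee> b = b"
  unfolding bl_le_def by (metis join_comm join_meet_absorb meet_comm meet_join_absorb)

lemma join_le_iff:
  assumes "a \<in> carrier A" "b \<in> carrier A" "c \<in> carrier A"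
  shows "a \<curlyvee> b \<preceq> c \<longleftrightarrow> a \<preceq> c \<and> b \<preceq> c"
proof
  have "a \<preceq> a \<curlyvee> b" "b \<preceq> a \<curlyvee> b"
    using assms unfolding bl_le_def by (metis join_comm meet_join_absorb)+
  then show "a \<preceq> c \<and> b \<preceq> c" if "a \<curlyvee> b \<preceq> c"
    using that assms bl_le_trans join_closed by blast
  show "a \<curlyvee> b \<preceq> c" if "a \<preceq> c \<and> b \<preceq> c"
    using that assms by (metis bl_le_iff_join join_assoc join_closed)
qed

text \<open>Follows by taking \<open>c\<close> to be \<open>a\<close> and then \<open>b\<close>.
  Infima and residua are accessible through their lower bounds, so equations between them are
  reduced to equivalences.\<close>

lemma eq_by_lower_bounds:
  assumes "a \<in> carrier A" "b \<in> carrier A" "\<And>c. c \<in> carrier A \<Longrightarrow> c \<preceq> a \<longleftrightarrow> c \<preceq> b"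
  shows "a = b"
  using assms bl_le_antisym bl_le_refl by blast

lemma eq_by_upper_bounds:
  assumes "a \<in> carrier A" "b \<in> carrier A" "\<And>c. c \<in> carrier A \<Longrightarrow> a \<preceq> c \<longleftrightarrow> b \<preceq> c"
  shows "a = b"
  using assms bl_le_antisym bl_le_refl by blast

lemma residuation':
  "\<lbrakk>a \<in> carrier A; b \<in> carrier A; c \<in> carrier A\<rbrakk> \<Longrightarrow> a \<otimes> b \<preceq> c \<longleftrightarrow> b \<preceq> a \<rightharpoonup> c"
  using residuation[of b a c] m_comm[of a b] by simp

lemma mult_right_mono:
  assumes "a \<preceq> b" "a \<in> carrier A" "b \<in> carrier A" "c \<in> carrier A"
  shows "a \<otimes> c \<preceq> b \<otimes> c"
proof -
  have "b \<preceq> c \<rightharpoonup> b \<otimes> c"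
    using assms bl_le_refl residuation[of b c "b \<otimes> c"] by simp
  then show ?thesis
    using assms bl_le_trans residuation imp_closed m_closed by metis
qed

text \<open>Residuation of \<open>\<one> \<otimes> a \<preceq> b\<close>, since
  \<open>\<one>\<close> is the top. It turns the axioms of the form "implication equals
  \<open>\<one>\<close>" into inequalities.\<close>

lemma imp_eq_one_iff:
  assumes "a \<in> carrier A" "b \<in> carrier A"
  shows "a \<rightharpoonup> b = \<one> \<longleftrightarrow> a \<preceq> b"
proof -
  have "a \<preceq> b \<longleftrightarrow> \<one> \<preceq> a \<rightharpoonup> b"
    using assms residuation[of \<one> a b] by simp
  then show ?thesis
    using assms bl_le_antisym bl_le_refl le_one imp_closed one_closed by metis
qed

text \<open>Multiplying \<open>x \<otimes> y\<close> by \<open>x \<rightharpoonup> y\<close>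
  replaces \<open>x\<close> by something below \<open>y\<close>, so the product is below
  \<open>y \<otimes> y\<close>; symmetrically for \<open>y \<rightharpoonup> x\<close>. Both residua
  thus lie below \<open>x \<otimes> y \<rightharpoonup> ?s\<close>, and by prelinearity their join
  is \<open>\<one>\<close>.\<close>

lemma mult_le_join_squares:
  assumes x: "x \<in> carrier A" and y: "y \<in> carrier A"
  shows "x \<otimes> y \<preceq> (x \<otimes> x) \<curlyvee> (y \<otimes> y)" (is "_ \<preceq> ?s")
proof -
  note cl = x y bl_closed
  \<comment> \<open>The pair \<open>(u, v)\<close> covers both orders of \<open>x\<close> and
    \<open>y\<close> at once, as \<open>x \<otimes> y\<close> and \<open>?s\<close> are
    symmetric.\<close>
  have le: "u \<rightharpoonup> v \<preceq> x \<otimes> y \<rightharpoonup> ?s"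
    if uv: "(u, v) = (x, y) \<or> (u, v) = (y, x)" for u v
  proof -
    have c: "u \<in> carrier A" "v \<in> carrier A"
      using uv cl by auto
    have "u \<otimes> (u \<rightharpoonup> v) \<preceq> v"
      using c cl by (simp add: residuation' bl_le_refl)
    then have "(u \<otimes> (u \<rightharpoonup> v)) \<otimes> v \<preceq> v \<otimes> v"
      using c by (intro mult_right_mono) (simp_all add: bl_closed)
    moreover have "v \<otimes> v \<preceq> ?s"
      using uv cl join_le_iff[of "x \<otimes> x" "y \<otimes> y" ?s] bl_le_refl[of ?s] by auto
    ultimately have "(u \<otimes> (u \<rightharpoonup> v)) \<otimes> v \<preceq> ?s"
      by (rule bl_le_trans) (use c cl in auto)
    moreover have "(u \<otimes> (u \<rightharpoonup> v)) \<otimes> v = (u \<rightharpoonup> v) \<otimes> (x \<otimes> y)"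
      using uv c imp_closed[of u v] by (auto simp: m_ac)
    ultimately show ?thesis
      using c cl by (simp add: residuation)
  qed
  have "(x \<rightharpoonup> y) \<curlyvee> (y \<rightharpoonup> x) \<preceq> x \<otimes> y \<rightharpoonup> ?s"
    using le cl by (simp add: join_le_iff)
  then have "\<one> \<preceq> x \<otimes> y \<rightharpoonup> ?s"
    using prelinearity x y by simp
  then show ?thesis
    using cl residuation[of \<one> "x \<otimes> y" ?s] by simp
qed

end

section \<open>Infima and suprema through their universal properties\<close>

context complete_bl_algebra
begin

lemma weak_complete: "weak_complete_lattice (bl_order A)"
proof -
  interpret L: complete_lattice "bl_order A"
    by (rule complete)
  show ?thesis
    by (rule L.weak.weak_complete_lattice_axioms)
qed

lemma bl_Inf_closed: "S \<subseteq> carrier A \<Longrightarrow> \<Sqinter>\<^bsub>bl_order A\<^esub> S \<in> carrier A"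
  using weak_complete_lattice.inf_closed[OF weak_complete, of S] by (simp add: bl_order_def)

lemma bl_Sup_closed: "S \<subseteq> carrier A \<Longrightarrow> \<Squnion>\<^bsub>bl_order A\<^esub> S \<in> carrier A"
  using weak_complete_lattice.sup_closed[OF weak_complete, of S] by (simp add: bl_order_def)

lemma le_bl_Inf_iff:
  assumes S: "S \<subseteq> carrier A" and c: "c \<in> carrier A"
  shows "c \<preceq> \<Sqinter>\<^bsub>bl_order A\<^esub> S \<longleftrightarrow> (\<forall>s\<in>S. c \<preceq> s)"
proof
  have "\<Sqinter>\<^bsub>bl_order A\<^esub> S \<preceq> s" if "s \<in> S" for s
    using weak_complete_lattice.inf_lower[OF weak_complete, of S s] S that by (simp add: bl_order_def)
  then show "\<forall>s\<in>S. c \<preceq> s" if "c \<preceq> \<Sqinter>\<^bsub>bl_order A\<^esub> S"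
    using that bl_le_trans bl_Inf_closed S c by blast
  show "c \<preceq> \<Sqinter>\<^bsub>bl_order A\<^esub> S" if "\<forall>s\<in>S. c \<preceq> s"
    using weak_complete_lattice.inf_greatest[OF weak_complete, of S c] S c that
    by (simp add: bl_order_def Lower_def subset_iff)
qed

lemma bl_Sup_le_iff:
  assumes S: "S \<subseteq> carrier A" and c: "c \<in> carrier A"
  shows "\<Squnion>\<^bsub>bl_order A\<^esub> S \<preceq> c \<longleftrightarrow> (\<forall>s\<in>S. s \<preceq> c)"
proof
  have "s \<preceq> \<Squnion>\<^bsub>bl_order A\<^esub> S" if "s \<in> S" for s
    using weak_complete_lattice.sup_upper[OF weak_complete, of S s] S that by (simp add: bl_order_def)
  then show "\<forall>s\<in>S. s \<preceq> c" if "\<Squnion>\<^bsub>bl_order A\<^esub> S \<preceq> c"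
    using that bl_le_trans bl_Sup_closed S c by blast
  show "\<Squnion>\<^bsub>bl_order A\<^esub> S \<preceq> c" if "\<forall>s\<in>S. s \<preceq> c"
    using weak_complete_lattice.sup_least[OF weak_complete, of S c] S c that
    by (simp add: bl_order_def Upper_def subset_iff)
qed

end

section \<open>The pointwise BL-algebra of functions on \<open>W\<close>\<close>

lemma complex_algebra_simps [simp]:
  "carrier (complex_algebra A W \<pi>) = (W \<rightarrow>\<^sub>E carrier A)"
  "f \<otimes>\<^bsub>complex_algebra A W \<pi>\<^esub> g = (\<lambda>w\<in>W. f w \<otimes>\<^bsub>A\<^esub> g w)"
  "\<one>\<^bsub>complex_algebra A W \<pi>\<^esub> = (\<lambda>w\<in>W. \<one>\<^bsub>A\<^esub>)"
  "f \<curlywedge>\<^bsub>complex_algebra A W \<pi>\<^esub> g = (\<lambda>w\<in>W. f w \<curlywedge>\<^bsub>A\<^esub> g w)"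
  "f \<curlyvee>\<^bsub>complex_algebra A W \<pi>\<^esub> g = (\<lambda>w\<in>W. f w \<curlyvee>\<^bsub>A\<^esub> g w)"
  "f \<rightharpoonup>\<^bsub>complex_algebra A W \<pi>\<^esub> g = (\<lambda>w\<in>W. f w \<rightharpoonup>\<^bsub>A\<^esub> g w)"
  "\<zero>\<^bsub>complex_algebra A W \<pi>\<^esub> = (\<lambda>w\<in>W. \<zero>\<^bsub>A\<^esub>)"
  by (simp_all add: complex_algebra_def)

lemma complex_algebra_le_iff:
  assumes "f \<in> W \<rightarrow>\<^sub>E carrier A"
  shows "f \<preceq>\<^bsub>complex_algebra A W \<pi>\<^esub> g \<longleftrightarrow> (\<forall>w\<in>W. f w \<preceq>\<^bsub>A\<^esub> g w)"
proof -
  \<comment> \<open>Both functions are \<open>undefined\<close> outside \<open>W\<close>, so only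
    the values on \<open>W\<close> matter.\<close>
  have "(\<lambda>w\<in>W. f w \<curlywedge>\<^bsub>A\<^esub> g w) = f \<longleftrightarrow> (\<forall>w\<in>W. f w \<curlywedge>\<^bsub>A\<^esub> g w = f w)"
    using assms by (auto simp: fun_eq_iff restrict_def PiE_def extensional_def)
  then show ?thesis
    by (simp add: bl_le_def)
qed

lemma (in bl_algebra) complex_algebra_bl_algebra: "bl_algebra (complex_algebra A W \<pi>)"
proof -
  have mem: "f w \<in> carrier A" if "f \<in> W \<rightarrow>\<^sub>E carrier A" "w \<in> W" for f w
    using that by auto
  have restrict_eq: "(\<lambda>w\<in>W. h w) = f \<longleftrightarrow> (\<forall>w\<in>W. h w = f w)"
    if "f \<in> W \<rightarrow>\<^sub>E carrier A" for f h
    using that by (auto simp: fun_eq_iff restrict_def PiE_def extensional_def)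
  have "comm_monoid (complex_algebra A W \<pi>)"
    by unfold_locales (auto intro!: restrict_ext simp: restrict_eq mem m_ac)
  moreover have "bl_algebra_axioms (complex_algebra A W \<pi>)"
    by unfold_locales
      (auto simp: complex_algebra_le_iff restrict_eq mem bl_closed meet_assoc join_assoc meet_join_absorb
        join_meet_absorb zero_le le_one residuation prelinearity
        intro!: restrict_ext intro: meet_comm join_comm divisibility)
  ultimately show ?thesis
    by (rule bl_algebra.intro)
qed

section \<open>Necessity and possibility over a possibilistic frame\<close>

locale bl_frame = complete_bl_algebra +
  fixes W :: "'w set" and \<pi> :: "'w \<Rightarrow> 'a"
  assumes frame: "possibilistic_frame A W \<pi>"
begin

text \<open>The modal operators produce constant functions; \<open>nec\<close> and
  \<open>pos\<close> keep only the constant, so that the modal laws become statements inside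
  \<open>A\<close>.\<close>

definition nec :: "('w \<Rightarrow> 'a) \<Rightarrow> 'a"
  where "nec f = \<Sqinter>\<^bsub>bl_order A\<^esub> {\<pi> w \<rightharpoonup> f w | w. w \<in> W}"

definition pos :: "('w \<Rightarrow> 'a) \<Rightarrow> 'a"
  where "pos f = \<Squnion>\<^bsub>bl_order A\<^esub> {\<pi> w \<otimes> f w | w. w \<in> W}"

lemma \<pi>_ext: "\<pi> \<in> W \<rightarrow>\<^sub>E carrier A"
  using frame by (simp add: possibilistic_frame_def)

lemma \<pi>_closed: "w \<in> W \<Longrightarrow> \<pi> w \<in> carrier A"
  using \<pi>_ext by auto

lemma nec_closed: "f \<in> W \<rightarrow> carrier A \<Longrightarrow> nec f \<in> carrier A"
  unfolding nec_def by (rule bl_Inf_closed) (auto simp: \<pi>_closed bl_closed Pi_iff)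

lemma pos_closed: "f \<in> W \<rightarrow> carrier A \<Longrightarrow> pos f \<in> carrier A"
  unfolding pos_def by (rule bl_Sup_closed) (auto simp: \<pi>_closed bl_closed Pi_iff)

lemma le_nec_iff:
  assumes "f \<in> W \<rightarrow> carrier A" "c \<in> carrier A"
  shows "c \<preceq> nec f \<longleftrightarrow> (\<forall>w\<in>W. c \<otimes> \<pi> w \<preceq> f w)"
proof -
  have "{\<pi> w \<rightharpoonup> f w | w. w \<in> W} \<subseteq> carrier A"
    using assms by (auto simp: \<pi>_closed bl_closed Pi_iff)
  from le_bl_Inf_iff[OF this assms(2)]
  have "c \<preceq> nec f \<longleftrightarrow> (\<forall>w\<in>W. c \<preceq> \<pi> w \<rightharpoonup> f w)"
    unfolding nec_def by blast
  also have "\<dots> \<longleftrightarrow> (\<forall>w\<in>W. c \<otimes> \<pi> w \<preceq> f w)"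
    using assms by (auto simp: residuation \<pi>_closed Pi_iff)
  finally show ?thesis .
qed

lemma pos_le_iff:
  assumes "f \<in> W \<rightarrow> carrier A" "c \<in> carrier A"
  shows "pos f \<preceq> c \<longleftrightarrow> (\<forall>w\<in>W. \<pi> w \<otimes> f w \<preceq> c)"
proof -
  have "{\<pi> w \<otimes> f w | w. w \<in> W} \<subseteq> carrier A"
    using assms by (auto simp: \<pi>_closed bl_closed Pi_iff)
  from bl_Sup_le_iff[OF this assms(2)] show ?thesis
    unfolding pos_def by blast
qed

text \<open>Moving \<open>k\<close> into the residuum \<open>k \<rightharpoonup> c\<close> leaves
  \<open>\<one>\<close> on the left, which is the supremum of \<pi>. This is how the normalization
  of the frame enters; it makes \<open>nec\<close> fix constants.\<close>

lemma le_iff_\<pi>_mult_le: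
  assumes k: "k \<in> carrier A" and c: "c \<in> carrier A"
  shows "k \<preceq> c \<longleftrightarrow> (\<forall>w\<in>W. \<pi> w \<otimes> k \<preceq> c)"
proof -
  have S: "{\<pi> w | w. w \<in> W} \<subseteq> carrier A"
    by (auto simp: \<pi>_closed)
  have "k \<preceq> c \<longleftrightarrow> \<one> \<preceq> k \<rightharpoonup> c"
    using k c residuation[of \<one> k c] by simp
  also have "\<dots> \<longleftrightarrow> \<Squnion>\<^bsub>bl_order A\<^esub> {\<pi> w | w. w \<in> W} \<preceq> k \<rightharpoonup> c"
    using frame by (simp add: possibilistic_frame_def)
  also have "\<dots> \<longleftrightarrow> (\<forall>w\<in>W. \<pi> w \<preceq> k \<rightharpoonup> c)"
    using bl_Sup_le_iff[OF S imp_closed[OF k c]] by blast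
  also have "\<dots> \<longleftrightarrow> (\<forall>w\<in>W. \<pi> w \<otimes> k \<preceq> c)"
    using k c by (simp add: residuation \<pi>_closed)
  finally show ?thesis .
qed

text \<open>Using the normalization twice leaves mixed products
  \<open>\<pi> v \<otimes> \<pi> w\<close> for two independent worlds; these are bounded by the join
  of the two squares, to which \<open>sq\<close> applies.\<close>

lemma le_if_\<pi>_square_mult_le:
  assumes k: "k \<in> carrier A" and c: "c \<in> carrier A"
    and sq: "\<And>w. w \<in> W \<Longrightarrow> (\<pi> w \<otimes> \<pi> w) \<otimes> k \<preceq> c"
  shows "k \<preceq> c"
proof -
  have "\<pi> v \<otimes> (\<pi> w \<otimes> k) \<preceq> c" if v: "v \<in> W" and w: "w \<in> W" for v w
  proof -
    note cl = \<pi>_closed[OF v] \<pi>_closed[OF w] k c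
    have "(\<pi> v \<otimes> \<pi> v) \<curlyvee> (\<pi> w \<otimes> \<pi> w) \<preceq> k \<rightharpoonup> c"
      using sq[OF v] sq[OF w] cl by (simp add: join_le_iff residuation bl_closed)
    with mult_le_join_squares[OF cl(1,2)] have "\<pi> v \<otimes> \<pi> w \<preceq> k \<rightharpoonup> c"
      by (rule bl_le_trans) (use cl in \<open>simp_all add: bl_closed\<close>)
    then show ?thesis
      using cl by (simp add: residuation[symmetric] m_assoc)
  qed
  then show ?thesis
    using le_iff_\<pi>_mult_le k c \<pi>_closed m_closed by metis
qed

text \<open>One factor \<open>\<pi> w\<close> brings \<open>nec f\<close> below \<open>f w\<close>,
  and a second one brings \<open>f w\<close> below \<open>pos f\<close>. Two factors being spent,
  the criterion with squares is the one that applies.\<close>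

lemma nec_le_pos:
  assumes f: "f \<in> W \<rightarrow> carrier A"
  shows "nec f \<preceq> pos f"
proof (rule le_if_\<pi>_square_mult_le)
  fix w assume w: "w \<in> W"
  have cl: "\<pi> w \<in> carrier A" "f w \<in> carrier A" "nec f \<in> carrier A" "pos f \<in> carrier A"
    using w f by (auto simp: \<pi>_closed nec_closed pos_closed)
  have "nec f \<otimes> \<pi> w \<preceq> f w"
    using le_nec_iff[OF f cl(3)] bl_le_refl[OF cl(3)] w by blast
  then have "(nec f \<otimes> \<pi> w) \<otimes> \<pi> w \<preceq> f w \<otimes> \<pi> w"
    using cl by (simp add: mult_right_mono)
  moreover have "f w \<otimes> \<pi> w \<preceq> pos f"
    using pos_le_iff[OF f cl(4)] bl_le_refl[OF cl(4)] w cl by (simp add: m_comm)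
  ultimately have "(nec f \<otimes> \<pi> w) \<otimes> \<pi> w \<preceq> pos f"
    by (rule bl_le_trans) (use cl in auto)
  then show "(\<pi> w \<otimes> \<pi> w) \<otimes> nec f \<preceq> pos f"
    using cl by (simp add: m_ac)
qed (use f in \<open>simp_all add: nec_closed pos_closed\<close>)

section \<open>The modal equations as identities in \<open>A\<close>\<close>

lemma nec_const:
  assumes "k \<in> carrier A"
  shows "nec (\<lambda>w\<in>W. k) = k"
  by (rule eq_by_lower_bounds)
    (use assms in \<open>auto simp: nec_closed le_nec_iff le_iff_\<pi>_mult_le[of _ k] m_comm \<pi>_closed\<close>)

text \<open>By normalization at \<open>\<zero>\<close>, the condition
  \<open>\<pi> w \<otimes> \<zero> \<preceq> c\<close> for all \<open>w\<close> is the same as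
  \<open>\<zero> \<preceq> c\<close>.\<close>

lemma pos_zero: "pos (\<lambda>w\<in>W. \<zero>) = \<zero>"
  by (rule eq_by_upper_bounds)
    (auto simp: pos_closed pos_le_iff bl_closed le_iff_\<pi>_mult_le[of \<zero>])

text \<open>A residuum turns a supremum in its first argument into an infimum: both sides have
  \<open>c\<close> as a lower bound exactly when
  \<open>c \<otimes> \<pi> w \<otimes> f w \<preceq> k\<close> for all \<open>w\<close>. The
  constant \<open>k\<close> plays the value of an inner necessity.\<close>

lemma nec_imp_const:
  assumes f: "f \<in> W \<rightarrow> carrier A" and k: "k \<in> carrier A"
  shows "nec (\<lambda>w\<in>W. f w \<rightharpoonup> k) = pos f \<rightharpoonup> k"
proof (rule eq_by_lower_bounds)
  fix c assume c: "c \<in> carrier A"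
  have "c \<otimes> \<pi> w \<preceq> f w \<rightharpoonup> k \<longleftrightarrow> \<pi> w \<otimes> f w \<preceq> c \<rightharpoonup> k" if w: "w \<in> W" for w
  proof -
    have cl: "\<pi> w \<in> carrier A" "f w \<in> carrier A"
      using w f by (auto simp: \<pi>_closed)
    then show ?thesis
      using c k by (simp add: residuation[symmetric] m_ac)
  qed
  then have "c \<preceq> nec (\<lambda>w\<in>W. f w \<rightharpoonup> k) \<longleftrightarrow> pos f \<preceq> c \<rightharpoonup> k"
    using f k c by (simp add: le_nec_iff pos_le_iff bl_closed Pi_iff)
  also have "\<dots> \<longleftrightarrow> c \<preceq> pos f \<rightharpoonup> k"
    using f k c by (simp add: residuation[symmetric] m_comm pos_closed)
  finally show "c \<preceq> nec (\<lambda>w\<in>W. f w \<rightharpoonup> k) \<longleftrightarrow> c \<preceq> pos f \<rightharpoonup> k" .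
qed (use f k in \<open>auto simp: bl_closed pos_closed Pi_iff intro!: nec_closed\<close>)

text \<open>The map \<open>k \<rightharpoonup> _\<close> is a right adjoint and preserves infima: a
  lower bound \<open>c\<close> on either side amounts to
  \<open>c \<otimes> k \<preceq> nec f\<close>.\<close>

lemma nec_const_imp:
  assumes f: "f \<in> W \<rightarrow> carrier A" and k: "k \<in> carrier A"
  shows "nec (\<lambda>w\<in>W. k \<rightharpoonup> f w) = k \<rightharpoonup> nec f"
proof (rule eq_by_lower_bounds)
  fix c assume c: "c \<in> carrier A"
  have "c \<otimes> \<pi> w \<preceq> k \<rightharpoonup> f w \<longleftrightarrow> (c \<otimes> k) \<otimes> \<pi> w \<preceq> f w" if w: "w \<in> W" for w
  proof -
    have cl: "\<pi> w \<in> carrier A" "f w \<in> carrier A"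
      using w f by (auto simp: \<pi>_closed)
    then show ?thesis
      using c k by (simp add: residuation[symmetric] m_ac)
  qed
  then have "c \<preceq> nec (\<lambda>w\<in>W. k \<rightharpoonup> f w) \<longleftrightarrow> c \<otimes> k \<preceq> nec f"
    using f k c by (simp add: le_nec_iff bl_closed Pi_iff)
  also have "\<dots> \<longleftrightarrow> c \<preceq> k \<rightharpoonup> nec f"
    using f k c by (simp add: residuation nec_closed)
  finally show "c \<preceq> nec (\<lambda>w\<in>W. k \<rightharpoonup> f w) \<longleftrightarrow> c \<preceq> k \<rightharpoonup> nec f" .
qed (use f k in \<open>auto simp: bl_closed nec_closed Pi_iff intro!: nec_closed\<close>)

lemma nec_meet:
  assumes f: "f \<in> W \<rightarrow> carrier A" and g: "g \<in> W \<rightarrow> carrier A"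
  shows "nec (\<lambda>w\<in>W. f w \<curlywedge> g w) = nec f \<curlywedge> nec g"
proof (rule eq_by_lower_bounds)
  fix c assume c: "c \<in> carrier A"
  have "c \<otimes> \<pi> w \<preceq> f w \<curlywedge> g w \<longleftrightarrow> c \<otimes> \<pi> w \<preceq> f w \<and> c \<otimes> \<pi> w \<preceq> g w" if "w \<in> W" for w
    using that f g c by (intro le_meet_iff) (auto simp: \<pi>_closed)
  then show "c \<preceq> nec (\<lambda>w\<in>W. f w \<curlywedge> g w) \<longleftrightarrow> c \<preceq> nec f \<curlywedge> nec g"
    using f g c by (auto simp: le_meet_iff nec_closed le_nec_iff bl_closed Pi_iff)
qed (use f g in \<open>auto simp: bl_closed nec_closed Pi_iff intro!: nec_closed\<close>)

text \<open>Multiplication by \<open>\<pi> w\<close> has a right adjoint, so it distributes over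
  joins, and an upper bound of a join is one of both parts.\<close>

lemma pos_join:
  assumes f: "f \<in> W \<rightarrow> carrier A" and g: "g \<in> W \<rightarrow> carrier A"
  shows "pos (\<lambda>w\<in>W. f w \<curlyvee> g w) = pos f \<curlyvee> pos g"
proof (rule eq_by_upper_bounds)
  fix c assume c: "c \<in> carrier A"
  have "\<pi> w \<otimes> (f w \<curlyvee> g w) \<preceq> c \<longleftrightarrow> \<pi> w \<otimes> f w \<preceq> c \<and> \<pi> w \<otimes> g w \<preceq> c" if w: "w \<in> W" for w
  proof -
    have cl: "\<pi> w \<in> carrier A" "f w \<in> carrier A" "g w \<in> carrier A"
      using w f g by (auto simp: \<pi>_closed)
    then show ?thesis
      using c by (simp add: residuation' join_le_iff bl_closed)
  qed
  then show "pos (\<lambda>w\<in>W. f w \<curlyvee> g w) \<preceq> c \<longleftrightarrow> pos f \<curlyvee> pos g \<preceq> c"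
    using f g c by (auto simp: join_le_iff pos_closed pos_le_iff bl_closed Pi_iff)
qed (use f g in \<open>auto simp: bl_closed pos_closed Pi_iff intro!: pos_closed\<close>)

text \<open>Multiplication by \<open>k\<close> is left adjoint to
  \<open>k \<rightharpoonup> _\<close>, hence commutes with the supremum defining
  \<open>pos\<close>.\<close>

lemma pos_mult_const:
  assumes f: "f \<in> W \<rightarrow> carrier A" and k: "k \<in> carrier A"
  shows "pos (\<lambda>w\<in>W. f w \<otimes> k) = pos f \<otimes> k"
proof (rule eq_by_upper_bounds)
  fix c assume c: "c \<in> carrier A"
  have "\<pi> w \<otimes> (f w \<otimes> k) \<preceq> c \<longleftrightarrow> \<pi> w \<otimes> f w \<preceq> k \<rightharpoonup> c" if w: "w \<in> W" for w
  proof -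
    have cl: "\<pi> w \<in> carrier A" "f w \<in> carrier A"
      using w f by (auto simp: \<pi>_closed)
    then show ?thesis
      using c k by (simp add: residuation[symmetric] m_assoc)
  qed
  then have "pos (\<lambda>w\<in>W. f w \<otimes> k) \<preceq> c \<longleftrightarrow> pos f \<preceq> k \<rightharpoonup> c"
    using f k c by (simp add: pos_le_iff bl_closed Pi_iff)
  also have "\<dots> \<longleftrightarrow> pos f \<otimes> k \<preceq> c"
    using f k c by (simp add: residuation pos_closed)
  finally show "pos (\<lambda>w\<in>W. f w \<otimes> k) \<preceq> c \<longleftrightarrow> pos f \<otimes> k \<preceq> c" .
qed (use f k in \<open>auto simp: bl_closed pos_closed Pi_iff intro!: pos_closed\<close>)

text \<open>The lower-bound criterion for \<open>nec\<close> at \<open>\<one>\<close>, where the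
  factor \<open>\<one>\<close> disappears.\<close>

lemma nec_eq_one_iff:
  assumes f: "f \<in> W \<rightarrow> carrier A"
  shows "nec f = \<one> \<longleftrightarrow> (\<forall>w\<in>W. \<pi> w \<preceq> f w)"
proof -
  have "nec f = \<one> \<longleftrightarrow> \<one> \<preceq> nec f"
    using f bl_le_antisym bl_le_refl le_one nec_closed one_closed by metis
  then show ?thesis
    using f by (simp add: le_nec_iff \<pi>_closed)
qed

section \<open>Transfer to the complex algebra and its focal element\<close>

abbreviation C :: "('w \<Rightarrow> 'a) ebl"
  where "C \<equiv> complex_algebra A W \<pi>"

lemma all_complex: "\<^bold>\<forall>\<^bsub>C\<^esub> f = (\<lambda>v\<in>W. nec f)"
  by (simp add: complex_algebra_def nec_def)

lemma ex_complex: "\<^bold>\<exists>\<^bsub>C\<^esub> f = (\<lambda>v\<in>W. pos f)"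
  by (simp add: complex_algebra_def pos_def)

lemma epistemic_complex_algebra: "epistemic_bl_algebra C"
proof -
  have cl: "f \<in> W \<rightarrow> carrier A" if "f \<in> W \<rightarrow>\<^sub>E carrier A" for f
    using that by auto
  \<comment> \<open>On \<open>W\<close> an inner modal term evaluates to its constant
    \<open>nec b\<close> or \<open>pos b\<close>, so every axiom compares two constant functions and
    becomes one of the identities in \<open>A\<close>.\<close>
  have "epistemic_bl_algebra_axioms C"
    by unfold_locales
      (auto simp: all_complex ex_complex cl nec_closed pos_closed nec_const pos_zero
        nec_imp_const nec_const_imp nec_meet pos_join pos_mult_const nec_le_pos
        imp_eq_one_iff bl_le_refl bl_closed cong: restrict_cong
        intro!: restrict_ext)
  with complex_algebra_bl_algebra show ?thesis
    by (rule epistemic_bl_algebra.intro)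
qed

text \<open>The functions of necessity \<open>\<one>\<close> are exactly those pointwise above
  \<pi>, and \<pi> itself is one of them.\<close>

lemma focal_complex_algebra: "focal_element C \<pi>"
proof -
  have ne: "W \<noteq> {}"
    using frame by (simp add: possibilistic_frame_def)
  have "\<^bold>\<forall>\<^bsub>C\<^esub> f = \<one>\<^bsub>C\<^esub> \<longleftrightarrow> (\<forall>w\<in>W. \<pi> w \<preceq> f w)" if "f \<in> W \<rightarrow>\<^sub>E carrier A" for f
  proof -
    \<comment> \<open>Equal constant functions have equal values because \<open>W\<close> is
      non-empty.\<close>
    have "\<^bold>\<forall>\<^bsub>C\<^esub> f = \<one>\<^bsub>C\<^esub> \<longleftrightarrow> nec f = \<one>"
      using ne by (auto simp: all_complex fun_eq_iff restrict_def)
    also have "\<dots> \<longleftrightarrow> (\<forall>w\<in>W. \<pi> w \<preceq> f w)"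
      using that by (intro nec_eq_one_iff) auto
    finally show ?thesis .
  qed
  then have "{f \<in> carrier C. \<^bold>\<forall>\<^bsub>C\<^esub> f = \<one>\<^bsub>C\<^esub>} = {f \<in> W \<rightarrow>\<^sub>E carrier A. \<forall>w\<in>W. \<pi> w \<preceq> f w}"
    by auto
  then show ?thesis
    unfolding focal_element_def least_def Lower_def
    using \<pi>_ext by (auto simp: bl_order_def complex_algebra_le_iff bl_le_refl \<pi>_closed)
qed

end

theorem theorem9:
  fixes A :: "('a, 'm) bl_scheme" and W :: "'w set" and \<pi> :: "'w \<Rightarrow> 'a"
  assumes "complete_bl_algebra A"
    and "possibilistic_frame A W \<pi>"
  shows "epistemic_bl_algebra (complex_algebra A W \<pi>)
    \<and> focal_element (complex_algebra A W \<pi>) \<pi>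
    \<and> c_ebl_algebra (complex_algebra A W \<pi>)"
proof -
  interpret bl_frame A W \<pi>
    using assms by (simp add: bl_frame_def bl_frame_axioms_def)
  show ?thesis
    using epistemic_complex_algebra focal_complex_algebra
    by (auto simp: c_ebl_algebra_def c_ebl_algebra_axioms_def)
qed

end
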